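(* For all integers $k\ge 1$ and $i,j\ge 0$, $$P^{(k)}_{i,j}=\frac{P_{i+(k-1),\,j}\cdot P_{i+(k-2),\,j+1}\cdots P_{i+1,\,j+(k-2)}\cdot P_{i,\,j+(k-1)}}{P_{i+j+(k-1),\,0}\cdot P_{i+j+(k-2),\,1}\cdots P_{i+j+1,\,k-2}\cdot P_{i+j,\,k-1}},$$ that is, $$P^{(k)}_{i,j}=\prod_{t=0}^{k-1}\frac{P_{i+(k-1)-t,\;j+t}}{P_{i+j+(k-1)-t,\;t}}.$$
   Context: The Pascal array is the infinite array $P=(P_{i,j})_{i,j\ge 0}$ with $P_{i,j}=\binom{i+j}{i}$. For $k\ge 1$ and $i,j\ge 0$, $P^{(k)}_{i,j}$ denotes the determinant of the $k\times k$ contiguous subarray of $P$ with top-left corner at $(i,j)$: $$P^{(k)}_{i,j}=\det\big(P_{i+a,\,j+b}\big)_{0\le a,b\le k-1}.$$ *)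

theory Defs
  imports "Jordan_Normal_Form.Determinant"
begin

definition pascal :: "nat \<Rightarrow> nat \<Rightarrow> int" where
  "pascal i j = int ((i + j) choose i)"

(* contiguous_minor A k i j: determinant of the k x k block of the infinite array A
   with top-left corner (i, j); for A = pascal this is P^(k)_{i,j}. *)
definition contiguous_minor ::
    "(nat \<Rightarrow> nat \<Rightarrow> 'a :: comm_ring_1) \<Rightarrow> nat \<Rightarrow> nat \<Rightarrow> nat \<Rightarrow> 'a" where
  "contiguous_minor A k i j = det (mat k k (\<lambda>(a, b). A (i + a) (j + b)))"

end

theory Submission
  imports Defs
begin

(* Clearing factorials, P(i+a, j+b) is a row factor times a column factor times
   (i+j+a+b choose b), and Vandermonde's convolution splits the latter as the (a, b) entry
   of a product of a lower and an upper unitriangular matrix. Hence the minor is the product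
   of the row and column factors. *)

lemma pascal_eq_fact:
  "(of_int (pascal i j) :: rat) = fact (i + j) / (fact i * fact j)"
  by (simp add: pascal_def binomial_fact)

text \<open>This is the (a, b) entry of a k x k matrix product, with the row factor (i+j+a)!/(i+a)!
  absorbed into the lower triangular matrix and the column factor b!/(j+b)! into the upper one. The
  guard \<open>c \<le> b\<close> is essential: truncated subtraction makes b - c zero for c > b, so
  the binomial would be 1 instead of 0.\<close>

lemma pascal_triangular_split:
  fixes k i j a b :: nat
  assumes "b < k"
  shows "(of_int (pascal (i + a) (j + b)) :: rat) =
    (\<Sum>c = 0..<k. (fact (i + j + a) / fact (i + a) * of_nat (a choose c)) *
       (if c \<le> b then of_nat ((i + j + b) choose (b - c)) * fact b / fact (j + b) else 0))"
proof -
  have "(of_int (pascal (i + a) (j + b)) :: rat) = 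
      fact (i + j + a) / fact (i + a) * of_nat ((a + (i + j + b)) choose b) * (fact b / fact (j + b))"
    by (simp add: pascal_eq_fact binomial_fact add_ac)
  also have "\<dots> = (\<Sum>c\<le>b. (fact (i + j + a) / fact (i + a) * of_nat (a choose c)) *
       (of_nat ((i + j + b) choose (b - c)) * fact b / fact (j + b)))"
    unfolding vandermonde[of a "i + j + b" b, symmetric] of_nat_sum sum_distrib_left sum_distrib_right
    by (intro sum.cong) simp_all
  \<comment> \<open>Since b < k, the Vandermonde range c \<le> b lies inside 0..<k, and the guard
    makes the added terms vanish.\<close>
  also have "\<dots> = (\<Sum>c = 0..<k. (fact (i + j + a) / fact (i + a) * of_nat (a choose c)) *
       (if c \<le> b then of_nat ((i + j + b) choose (b - c)) * fact b / fact (j + b) else 0))"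
    using assms by (intro sum.mono_neutral_cong_left) auto
  finally show ?thesis .
qed

lemma pascal_minor_eq_fact:
  "(of_int (contiguous_minor pascal k i j) :: rat) =
     (\<Prod>a = 0..<k. fact (i + j + a) / fact (i + a) * (fact a / fact (j + a)))"
proof -
  define L :: "rat mat" where
    "L = mat k k (\<lambda>(a, c). fact (i + j + a) / fact (i + a) * of_nat (a choose c))"
  define U :: "rat mat" where
    "U = mat k k (\<lambda>(c, b).
       if c \<le> b then of_nat ((i + j + b) choose (b - c)) * fact b / fact (j + b) else 0)"
  have L: "L \<in> carrier_mat k k" and U: "U \<in> carrier_mat k k"
    by (auto simp: L_def U_def)
  have "(of_int (contiguous_minor pascal k i j) :: rat) =
      det (map_mat of_int (mat k k (\<lambda>(a, b). pascal (i + a) (j + b))))"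
    by (simp add: contiguous_minor_def of_int_hom.hom_det)
  also have "map_mat of_int (mat k k (\<lambda>(a, b). pascal (i + a) (j + b))) = L * U"
    by (rule eq_matI) (auto simp: L_def U_def scalar_prod_def pascal_triangular_split)
  also have "det (L * U) = det L * det U"
    by (rule det_mult[OF L U])
  \<comment> \<open>Above the diagonal \<open>a choose c\<close> vanishes because a < c; on it the
    binomials in both \<open>L\<close> and \<open>U\<close> are 1, so only the row and column
    factors survive.\<close>
  also have "det L = prod_list (diag_mat L)"
    by (rule det_lower_triangular[OF _ L]) (auto simp: L_def)
  also have "det U = prod_list (diag_mat U)"
    by (rule det_upper_triangular[OF _ U]) (auto simp: U_def)
  finally show ?thesis
    by (simp add: prod_list_diag_prod L_def U_def flip: prod.distrib)
qed

theorem mainTheorem3: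
  fixes k i j :: nat
  assumes "k \<ge> 1"
  shows "(of_int (contiguous_minor pascal k i j) :: rat) =
           (\<Prod>t = 0..k - 1. of_int (pascal (i + (k - 1) - t) (j + t))) /
           (\<Prod>t = 0..k - 1. of_int (pascal (i + j + (k - 1) - t) t))
       \<and> (of_int (contiguous_minor pascal k i j) :: rat) =
           (\<Prod>t = 0..k - 1. of_int (pascal (i + (k - 1) - t) (j + t)) /
                              of_int (pascal (i + j + (k - 1) - t) t))"
proof -
  obtain m where k: "k = Suc m"
    using assms by (cases k) auto
  have reflect: "(\<Prod>t = 0..m. f (m - t)) = (\<Prod>t = 0..m. f t)" for f :: "nat \<Rightarrow> rat"
    by (rule prod.reindex_bij_witness[of _ "\<lambda>t. m - t" "\<lambda>t. m - t"]) auto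
  \<comment> \<open>Numerator and denominator of each quotient lie on the same antidiagonal of index
    sum i+j+m, so (i+j+m)! cancels.\<close>
  have "(\<Prod>t = 0..m. of_int (pascal (i + m - t) (j + t)) / of_int (pascal (i + j + m - t) t) :: rat) =
      (\<Prod>t = 0..m. fact (i + j + (m - t)) / fact (i + (m - t)) * (fact t / fact (j + t)))"
    by (intro prod.cong) (auto simp: pascal_eq_fact add_ac)
  \<comment> \<open>The quotient at t pairs row factor m - t with column factor t; only the row
    product is reversed.\<close>
  also have "\<dots> = (\<Prod>t = 0..m. fact (i + j + t) / fact (i + t) * (fact t / fact (j + t)))"
    using reflect[of "\<lambda>t. fact (i + j + t) / fact (i + t)"] by (simp only: prod.distrib)
  also have "\<dots> = of_int (contiguous_minor pascal k i j)"
    by (simp add: pascal_minor_eq_fact k atLeastLessThanSuc_atLeastAtMost)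
  finally show ?thesis
    by (simp add: k prod_dividef)
qed

end
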